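(* There exists $\nu_0 \in \mathbb{N}$ such that for every integer $\nu > \nu_0$ there exists a bipartite graph $G$ of order $n = 2\nu$ with $\delta_{loc}(G) > 0.110\, n$.
   Context: All graphs are finite, simple and undirected. The local complementation of a graph $G$ at a vertex $u$ is the graph $G * u = G \,\Delta\, K_{\mathcal{N}(u)}$, i.e. the edge set is replaced by its symmetric difference with the edge set of the complete graph on the neighborhood $\mathcal{N}(u)$ of $u$. Two graphs are locally equivalent, $G \equiv_{LC} G'$, if one can be obtained from the other by a finite sequence of local complementations. The local minimum degree is $\delta_{loc}(G) = \min\{\delta(G') : G' \equiv_{LC} G\}$, where $\delta(G')$ denotes the minimum degree of $G'$. *)

theory Defs
  imports Complex_Main "Graph_Theory.Graph_Theory"
begin

text \<open>
  Finite simple undirected graphs are the library's \<^locale>\<open>pair_graph\<close>: finite, loop-free,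
  symmetric digraphs whose arcs are ordered pairs. An undirected edge \<open>xy\<close> is the pair of
  arcs \<open>(x, y)\<close>, \<open>(y, x)\<close>, so the degree of a vertex is its out-degree.
\<close>

definition neighborhood :: "'a pair_pre_digraph \<Rightarrow> 'a \<Rightarrow> 'a set" where
  "neighborhood G u = {v. (u, v) \<in> parcs G}"

definition complete_arcs :: "'a set \<Rightarrow> 'a rel" where
  "complete_arcs S = {(x, y). x \<in> S \<and> y \<in> S \<and> x \<noteq> y}"

definition local_complement :: "'a pair_pre_digraph \<Rightarrow> 'a \<Rightarrow> 'a pair_pre_digraph" where
  "local_complement G u =
     \<lparr> pverts = pverts G,
       parcs = (parcs G - complete_arcs (neighborhood G u)) \<union>
               (complete_arcs (neighborhood G u) - parcs G) \<rparr>"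

definition local_complement_step :: "'a pair_pre_digraph \<Rightarrow> 'a pair_pre_digraph \<Rightarrow> bool" where
  "local_complement_step G G' \<longleftrightarrow> (\<exists>u \<in> pverts G. G' = local_complement G u)"

text \<open>
  Reachability from \<open>G\<close> to \<open>G'\<close> suffices: local complementation at a fixed vertex is an
  involution on graphs, so the relation is symmetric there (\<open>locally_equivalent_sym\<close> below).
\<close>
definition locally_equivalent :: "'a pair_pre_digraph \<Rightarrow> 'a pair_pre_digraph \<Rightarrow> bool" where
  "locally_equivalent G G' \<longleftrightarrow> local_complement_step\<^sup>*\<^sup>* G G'"

text \<open>Only meaningful if \<open>G\<close> has a vertex, since \<open>Min {}\<close> is unspecified.\<close>
definition min_degree :: "'a pair_pre_digraph \<Rightarrow> nat" where
  "min_degree G = Min (out_degree (with_proj G) ` pverts G)"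

text \<open>The minimum is over a finite nonempty set, see \<open>finite_locally_equivalent\<close> below.\<close>
definition local_min_degree :: "'a pair_pre_digraph \<Rightarrow> nat" where
  "local_min_degree G = Min (min_degree ` {G'. locally_equivalent G G'})"

definition bipartite :: "'a pair_pre_digraph \<Rightarrow> bool" where
  "bipartite G \<longleftrightarrow>
     (\<exists>A B. pverts G = A \<union> B \<and> A \<inter> B = {} \<and> parcs G \<subseteq> A \<times> B \<union> B \<times> A)"

lemma out_degree_eq_card_neighborhood:
  "out_degree (with_proj G) v = card (neighborhood G v)"
proof -
  have "out_arcs (with_proj G) v = Pair v ` neighborhood G v"
    by (auto simp: out_arcs_def neighborhood_def)
  then show ?thesis
    by (simp add: out_degree_def card_image inj_on_def)
qed

lemma pair_graph_iff:
  "pair_graph G \<longleftrightarrow> finite (pverts G) \<and> parcs G \<subseteq> pverts G \<times> pverts G \<and>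
     (\<forall>x. (x, x) \<notin> parcs G) \<and> sym (parcs G)" (is "_ \<longleftrightarrow> ?R")
proof
  assume "pair_graph G"
  then interpret pair_graph G .
  show ?R
    using pair_finite_verts in_arcsD1 in_arcsD2 no_loops' arcs_symmetric
    by (auto intro!: symI) blast
next
  assume R: ?R
  then have "finite (parcs G)"
    by (meson finite_SigmaI finite_subset)
  with R show "pair_graph G"
    by unfold_locales (auto simp: symmetric_def)
qed

lemma pair_graph_local_complement:
  assumes "pair_graph G"
  shows "pair_graph (local_complement G u)"
  using assms unfolding pair_graph_iff
  by (auto simp: local_complement_def complete_arcs_def neighborhood_def sym_def)

lemma local_complement_involution:
  assumes "pair_graph G"
  shows "local_complement (local_complement G u) u = G"
proof -
  let ?K = "complete_arcs (neighborhood G u)" and ?H = "local_complement G u"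
  have H: "pverts ?H = pverts G" "parcs ?H = (parcs G - ?K) \<union> (?K - parcs G)"
    by (simp_all add: local_complement_def)
  have "neighborhood ?H u = neighborhood G u"
    using assms unfolding pair_graph_iff
    by (auto simp: local_complement_def complete_arcs_def neighborhood_def)
  then have "local_complement ?H u =
      \<lparr>pverts = pverts G, parcs = (parcs ?H - ?K) \<union> (?K - parcs ?H)\<rparr>"
    unfolding local_complement_def[of ?H] by (simp add: H(1))
  also have "(parcs ?H - ?K) \<union> (?K - parcs ?H) = parcs G"
    unfolding H by blast
  finally show ?thesis
    by simp
qed

lemma pair_graph_locally_equivalent:
  assumes "locally_equivalent G G'" "pair_graph G"
  shows "pair_graph G' \<and> pverts G' = pverts G"
  using assms(1) unfolding locally_equivalent_def
proof (induction rule: rtranclp_induct)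
  case (step H K)
  then obtain u where "K = local_complement H u"
    by (auto simp: local_complement_step_def)
  then show ?case
    using step.IH pair_graph_local_complement[of H u] by (simp add: local_complement_def)
qed (simp add: assms(2))

lemma locally_equivalent_sym:
  assumes "pair_graph G" "locally_equivalent G G'"
  shows "locally_equivalent G' G"
  using assms(2) unfolding locally_equivalent_def
proof (induction rule: rtranclp_induct)
  case (step H K)
  have H: "pair_graph H"
    using step.hyps(1) assms(1) pair_graph_locally_equivalent locally_equivalent_def by metis
  from step.hyps(2) obtain u where u: "u \<in> pverts H" "K = local_complement H u"
    by (auto simp: local_complement_step_def)
  then have "local_complement_step K H"
    using local_complement_involution[OF H, of u]
    by (auto simp: local_complement_step_def intro!: bexI[of _ u]) (simp add: local_complement_def)
  then show ?case
    using step.IH by (rule converse_rtranclp_into_rtranclp)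
qed simp

lemma finite_locally_equivalent:
  assumes "pair_graph G"
  shows "finite {G'. locally_equivalent G G'}" and "G \<in> {G'. locally_equivalent G G'}"
proof -
  let ?F = "(\<lambda>E. \<lparr>pverts = pverts G, parcs = E\<rparr>) ` Pow (pverts G \<times> pverts G)"
  have "{G'. locally_equivalent G G'} \<subseteq> ?F"
  proof
    fix G' assume "G' \<in> {G'. locally_equivalent G G'}"
    then have "pair_graph G'" "pverts G' = pverts G"
      using pair_graph_locally_equivalent[OF _ assms] by auto
    then show "G' \<in> ?F"
      unfolding pair_graph_iff by (intro image_eqI[of _ _ "parcs G'"]) auto
  qed
  moreover have "finite ?F"
    using assms unfolding pair_graph_iff by auto
  ultimately show "finite {G'. locally_equivalent G G'}"
    by (rule finite_subset)
  show "G \<in> {G'. locally_equivalent G G'}"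
    by (simp add: locally_equivalent_def)
qed

end

theory Submission
  imports Defs
begin

text \<open>
  A vertex of degree \<open>d\<close> in a graph locally equivalent to \<open>G\<close> yields a nonempty vertex set \<open>L\<close>
  such that \<open>L\<close> together with the vertices having an odd number of neighbours in \<open>L\<close> consists of
  \<open>d + 1\<close> vertices, and the sizes of the sets \<open>L \<union> Odd(L)\<close> do not change under local
  complementation. In a bipartite graph with biadjacency matrix \<open>M\<close>, these sets are large as soon
  as the two binary codes \<open>{(x, M x)}\<close> and \<open>{(y, M\<^sup>T y)}\<close>, of length \<open>2 \<nu>\<close> and rate \<open>1/2\<close>, have
  large minimum distance. By the Gilbert--Varshamov counting argument most \<open>M\<close> give relative
  distance above \<open>0.11\<close>, because the binary entropy of \<open>0.11\<close> is (barely) below \<open>1/2\<close>.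
\<close>

text \<open>For finite \<open>L\<close> this is matrix-vector multiplication over GF(2): the support
  of the row vector \<open>L\<close> times the 0/1 matrix of \<open>E\<close>.\<close>

definition odd_image :: "('a \<times> 'b) set \<Rightarrow> 'a set \<Rightarrow> 'b set" where
  "odd_image E L = {v. odd (card {a \<in> L. (a, v) \<in> E})}"

lemma odd_card_sym_diff:
  assumes "finite A" "finite B"
  shows "odd (card (sym_diff A B)) \<longleftrightarrow> odd (card A) \<noteq> odd (card B)"
proof -
  have "card (sym_diff A B) = card (A - B) + card (B - A)"
    using assms by (intro card_Un_disjoint) auto
  moreover have "card A = card (A - B) + card (A \<inter> B)" "card B = card (B - A) + card (A \<inter> B)"
    using assms by (metis card_Int_Diff add.commute, metis card_Int_Diff add.commute inf_commute)
  ultimately show ?thesis by presburger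
qed

section \<open>Invariance under local complementation\<close>

text \<open>For a neighbour \<open>v\<close> of \<open>u\<close> outside \<open>L\<close>,
  complementing at \<open>u\<close> changes the parity at \<open>v\<close> by the parity of the
  number of neighbours of \<open>u\<close> in the set. If that number is odd, toggling
  \<open>u\<close> in the set cancels the change, as \<open>u\<close> is itself a neighbour of
  \<open>v\<close>. In that case \<open>u\<close> lies in both odd sets, so toggling it does not
  affect the union.\<close>

lemma local_complement_odd_image:
  assumes G: "pair_graph G" and L: "L \<subseteq> pverts G" "L \<noteq> {}" and u: "u \<in> pverts G"
  obtains L' where "L' \<subseteq> pverts G" "L' \<noteq> {}"
    "L' \<union> odd_image (parcs (local_complement G u)) L' = L \<union> odd_image (parcs G) L"
proof -
  let ?E = "parcs G" and ?E' = "parcs (local_complement G u)"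
  have fin: "finite (pverts G)" and irr: "\<And>x. (x, x) \<notin> ?E"
    and sym: "\<And>x y. (x, y) \<in> ?E \<Longrightarrow> (y, x) \<in> ?E"
    using G unfolding pair_graph_iff by (auto dest: symD)
  define L' where "L' = (if u \<in> odd_image ?E L then sym_diff L {u} else L)"
  have finL: "finite L" using L fin finite_subset by blast
  then have finL': "finite L'" unfolding L'_def by auto
  have E': "(a, v) \<in> ?E' \<longleftrightarrow> ((a, v) \<in> ?E) \<noteq> ((a, u) \<in> ?E \<and> (v, u) \<in> ?E \<and> a \<noteq> v)" for a v
    using sym by (auto simp: local_complement_def complete_arcs_def neighborhood_def)
  have nonadj: "v \<in> odd_image ?E' L' \<longleftrightarrow> v \<in> odd_image ?E L" if "(v, u) \<notin> ?E" for v
  proof -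
    have "{a \<in> L'. (a, v) \<in> ?E'} = {a \<in> L. (a, v) \<in> ?E}"
      using that sym unfolding L'_def by (auto simp: E')
    then show ?thesis unfolding odd_image_def by simp
  qed
  \<comment> \<open>Parities at vertices of \<open>L\<close> may change, but those other than
    \<open>u\<close> stay in \<open>L'\<close> and hence in the union.\<close>
  have adj: "v \<in> odd_image ?E' L' \<longleftrightarrow> v \<in> odd_image ?E L" if v: "(v, u) \<in> ?E" "v \<notin> L" for v
  proof -
    let ?N = "\<lambda>v L. {a \<in> L. (a, v) \<in> ?E}"
    have "v \<noteq> u" using v irr by blast
    then have "v \<notin> L'" using v(2) unfolding L'_def by auto
    then have "{a \<in> L'. (a, v) \<in> ?E'} = sym_diff (?N v L') (?N u L')"
      using v by (auto simp: E')
    then have 1: "v \<in> odd_image ?E' L' \<longleftrightarrow> odd (card (?N v L')) \<noteq> odd (card (?N u L'))"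
      unfolding odd_image_def using finL' by (simp add: odd_card_sym_diff)
    have 2: "?N u L' = ?N u L" unfolding L'_def using irr by auto
    show ?thesis
    proof (cases "u \<in> odd_image ?E L")
      case True
      have "?N v L' = sym_diff (?N v L) {u}"
        using True sym[OF v(1)] unfolding L'_def by auto
      then have "odd (card (?N v L')) \<longleftrightarrow> \<not> odd (card (?N v L))"
        using finL odd_card_sym_diff[of "?N v L" "{u}"] by simp
      then show ?thesis using True 1 2 unfolding odd_image_def by simp
    next
      case False
      then show ?thesis using 1 2 unfolding odd_image_def L'_def by simp
    qed
  qed
  have uu: "u \<in> odd_image ?E' L' \<longleftrightarrow> u \<in> odd_image ?E L"
    using nonadj irr by blast
  have "L' \<subseteq> pverts G" using L u unfolding L'_def by auto
  moreover have "L' \<noteq> {}"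
  proof
    assume "L' = {}"
    then have "u \<in> odd_image ?E L" "L = {u}"
      using L(2) unfolding L'_def by (auto split: if_splits)
    moreover have "{a \<in> {u}. (a, u) \<in> ?E} = {}" using irr by blast
    ultimately show False unfolding odd_image_def mem_Collect_eq by (metis card.empty even_zero)
  qed
  moreover have "v \<in> L' \<union> odd_image ?E' L' \<longleftrightarrow> v \<in> L \<union> odd_image ?E L" for v
  proof (cases "v = u")
    case True
    then show ?thesis using uu unfolding L'_def by auto
  next
    case False
    then have "v \<in> L' \<longleftrightarrow> v \<in> L" unfolding L'_def by auto
    then show ?thesis using adj nonadj by blast
  qed
  ultimately show ?thesis using that by blast
qed

lemma locally_equivalent_odd_image:
  assumes "locally_equivalent G G'" "pair_graph G" "L \<subseteq> pverts G" "L \<noteq> {}"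
  shows "\<exists>L' \<subseteq> pverts G. L' \<noteq> {} \<and> L' \<union> odd_image (parcs G') L' = L \<union> odd_image (parcs G) L"
  using assms(1) unfolding locally_equivalent_def
proof (induction rule: rtranclp_induct)
  case base
  then show ?case using assms by blast
next
  case (step H K)
  then have H: "pair_graph H" "pverts H = pverts G"
    using pair_graph_locally_equivalent[of G H] assms(2) by (auto simp: locally_equivalent_def)
  obtain u where u: "u \<in> pverts H" "K = local_complement H u"
    using step.hyps(2) by (auto simp: local_complement_step_def)
  obtain L1 where L1: "L1 \<subseteq> pverts G" "L1 \<noteq> {}"
    "L1 \<union> odd_image (parcs H) L1 = L \<union> odd_image (parcs G) L"
    using step.IH by blast
  obtain L' where "L' \<subseteq> pverts H" "L' \<noteq> {}"
    "L' \<union> odd_image (parcs K) L' = L1 \<union> odd_image (parcs H) L1"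
    using local_complement_odd_image[OF H(1), of L1 u] L1 H u by metis
  then show ?case using L1 H by metis
qed

text \<open>For a singleton \<open>{v}\<close> the union is the closed neighbourhood of
  \<open>v\<close>; the \<open>Suc\<close> accounts for \<open>v\<close> itself.\<close>

lemma less_local_min_degreeI:
  assumes G: "pair_graph G" and ne: "pverts G \<noteq> {}"
    and L: "\<And>L. \<lbrakk>L \<subseteq> pverts G; L \<noteq> {}\<rbrakk> \<Longrightarrow> Suc k < card (L \<union> odd_image (parcs G) L)"
  shows "k < local_min_degree G"
proof -
  have "k < min_degree H" if GH: "locally_equivalent G H" for H
  proof -
    have H: "pair_graph H" "pverts H = pverts G"
      using pair_graph_locally_equivalent[OF GH G] by auto
    have "k < out_degree (with_proj H) v" if v: "v \<in> pverts H" for v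
    proof -
      have "odd_image (parcs H) {v} = neighborhood H v"
        unfolding odd_image_def neighborhood_def
        by (auto simp: Collect_conv_if conj_commute cong: conj_cong)
      moreover have "finite (neighborhood H v)"
        by (rule finite_subset[of _ "pverts H"])
          (use H(1) in \<open>auto simp: neighborhood_def pair_graph_iff\<close>)
      moreover have "v \<notin> neighborhood H v"
        using H(1) by (auto simp: neighborhood_def pair_graph_iff)
      ultimately have "card ({v} \<union> odd_image (parcs H) {v}) = Suc (card (neighborhood H v))"
        by simp
      \<comment> \<open>The invariance is used backwards, from \<open>H\<close> to \<open>G\<close>,
        so that only sets in \<open>G\<close> need to be bounded.\<close>
      moreover obtain L' where "L' \<subseteq> pverts G" "L' \<noteq> {}"
        "L' \<union> odd_image (parcs G) L' = {v} \<union> odd_image (parcs H) {v}"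
        using locally_equivalent_odd_image[OF locally_equivalent_sym[OF G GH] H(1), of "{v}"] v H
        by auto
      ultimately show ?thesis
        using L[of L'] by (simp add: out_degree_eq_card_neighborhood)
    qed
    then show ?thesis
      unfolding min_degree_def using H G ne by (subst Min_gr_iff) (auto simp: pair_graph_iff)
  qed
  then show ?thesis
    unfolding local_min_degree_def using finite_locally_equivalent[OF G]
    by (subst Min_gr_iff) auto
qed

section \<open>Counting relations with a sparse pair\<close>

text \<open>Toggling the arcs \<open>{a} \<times> S\<close>, for a fixed \<open>a \<in> x\<close>, changes \<open>odd_image E x\<close> by exactly \<open>S\<close>.\<close>

lemma card_odd_image_eq:
  assumes fin: "finite A" "finite B" and x: "x \<subseteq> A" "x \<noteq> {}"
  shows "card {E \<in> Pow (A \<times> B). odd_image E x = y} * 2 ^ card B \<le> 2 ^ (card A * card B)"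
proof -
  obtain a where a: "a \<in> x" using x by blast
  have finx: "finite x" using x fin finite_subset by blast
  let ?F = "{E \<in> Pow (A \<times> B). odd_image E x = y}"
  define f :: "('a \<times> 'b) set \<times> 'b set \<Rightarrow> ('a \<times> 'b) set"
    where "f = (\<lambda>(E, S). sym_diff E ({a} \<times> S))"
  have odd_f: "odd_image (f (E, S)) x = sym_diff (odd_image E x) S" for E S
  proof -
    have "b \<in> odd_image (f (E, S)) x \<longleftrightarrow> b \<in> sym_diff (odd_image E x) S" for b
    proof (cases "b \<in> S")
      case True
      then have "{c \<in> x. (c, b) \<in> f (E, S)} = sym_diff {c \<in> x. (c, b) \<in> E} {a}"
        using a unfolding f_def by auto
      then show ?thesis
        using True finx odd_card_sym_diff[of "{c \<in> x. (c, b) \<in> E}" "{a}"]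
        unfolding odd_image_def by simp
    next
      case False
      then have "{c \<in> x. (c, b) \<in> f (E, S)} = {c \<in> x. (c, b) \<in> E}"
        unfolding f_def by auto
      then show ?thesis using False unfolding odd_image_def by simp
    qed
    then show ?thesis by blast
  qed
  \<comment> \<open>\<open>S\<close> is recovered as the difference between the new odd image and
    \<open>y\<close>; toggling \<open>{a} \<times> S\<close> once more then recovers
    \<open>E\<close>.\<close>
  have "inj_on f (?F \<times> Pow B)"
  proof (rule inj_onI, clarify)
    fix E S E' S'
    assume eq: "f (E, S) = f (E', S')" and y: "y = odd_image E x" "odd_image E' x = odd_image E x"
    have "sym_diff (odd_image E x) S = sym_diff (odd_image E x) S'"
      using odd_f[of E S] odd_f[of E' S'] eq y by simp
    then have "S = S'" by blast
    moreover have "E = sym_diff (f (E, S)) ({a} \<times> S)" "E' = sym_diff (f (E', S')) ({a} \<times> S')"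
      unfolding f_def by auto
    ultimately show "E = E' \<and> S = S'" using eq by simp
  qed
  moreover have "f ` (?F \<times> Pow B) \<subseteq> Pow (A \<times> B)"
    using a x unfolding f_def by auto
  ultimately have "card (?F \<times> Pow B) \<le> card (Pow (A \<times> B))"
    using fin by (intro card_inj_on_le) auto
  then show ?thesis using fin by (simp add: card_cartesian_product card_Pow)
qed

lemma sum_power_card_Pow:
  fixes t :: "'b::comm_semiring_1"
  assumes "finite A"
  shows "(\<Sum>x\<in>Pow A. t ^ card x) = (1 + t) ^ card A"
  using prod_add[OF assms, of "\<lambda>_. t" "\<lambda>_. 1"] by (simp add: add.commute)

text \<open>A Chernoff-type bound on a Hamming ball: give each pair the weight
  \<open>t ^ (card x + card y)\<close>. Pairs in the ball weigh at least \<open>t ^ D\<close>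
  because \<open>t \<le> 1\<close>, and the weight of all pairs factors by the binomial
  theorem.\<close>

lemma card_sparse_pairs:
  fixes t :: real
  assumes fin: "finite A" "finite B" and t: "0 < t" "t \<le> 1"
  shows "real (card {(x, y) \<in> Pow A \<times> Pow B. card x + card y \<le> D}) * t ^ D
    \<le> (1 + t) ^ (card A + card B)"
proof -
  let ?S = "{(x, y) \<in> Pow A \<times> Pow B. card x + card y \<le> D}"
  have "real (card ?S) * t ^ D = (\<Sum>p\<in>?S. t ^ D)" by simp
  also have "\<dots> \<le> (\<Sum>(x, y)\<in>?S. t ^ card x * t ^ card y)"
    using t by (intro sum_mono) (auto simp flip: power_add intro: power_decreasing)
  also have "\<dots> \<le> (\<Sum>(x, y)\<in>Pow A \<times> Pow B. t ^ card x * t ^ card y)"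
    using fin t by (intro sum_mono2) auto
  also have "\<dots> = (\<Sum>x\<in>Pow A. t ^ card x) * (\<Sum>y\<in>Pow B. t ^ card y)"
    by (simp add: sum_product sum.cartesian_product)
  also have "\<dots> = (1 + t) ^ (card A + card B)"
    using fin by (simp add: sum_power_card_Pow power_add)
  finally show ?thesis .
qed

text \<open>The matrices whose code \<open>{(x, x E)}\<close> has a nonzero word of weight at most
  \<open>D\<close>.\<close>

definition sparse_rels :: "'a set \<Rightarrow> 'b set \<Rightarrow> nat \<Rightarrow> ('a \<times> 'b) set set" where
  "sparse_rels A B D =
    {E \<in> Pow (A \<times> B). \<exists>x \<subseteq> A. x \<noteq> {} \<and> card x + card (odd_image E x) \<le> D}"

lemma finite_sparse_rels: "finite A \<Longrightarrow> finite B \<Longrightarrow> finite (sparse_rels A B D)"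
  unfolding sparse_rels_def by simp

text \<open>Union bound over the light pairs \<open>(x, y)\<close>: each is realised by at most a
  fraction \<open>1 / 2 ^ card B\<close> of all relations.\<close>

lemma card_sparse_rels:
  fixes t :: real
  assumes fin: "finite A" "finite B" and t: "0 < t" "t \<le> 1"
  shows "real (card (sparse_rels A B D)) * 2 ^ card B * t ^ D
    \<le> 2 ^ (card A * card B) * (1 + t) ^ (card A + card B)"
proof -
  let ?S = "{(x, y) \<in> Pow A \<times> Pow B. card x + card y \<le> D}"
  let ?S' = "{(x, y) \<in> ?S. x \<noteq> {}}"
  let ?F = "\<lambda>(x, y). {E \<in> Pow (A \<times> B). odd_image E x = y}"
  have finS: "finite ?S" by (rule finite_subset[of _ "Pow A \<times> Pow B"]) (use fin in auto)
  then have finS': "finite ?S'" by (rule rev_finite_subset) auto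
  have "odd_image E x \<subseteq> B" if "E \<subseteq> A \<times> B" for E x
  proof
    fix b assume "b \<in> odd_image E x"
    then have "{a \<in> x. (a, b) \<in> E} \<noteq> {}" unfolding odd_image_def by (auto simp del: Collect_empty_eq)
    then show "b \<in> B" using that by auto
  qed
  then have "sparse_rels A B D \<subseteq> (\<Union>p\<in>?S'. ?F p)"
    unfolding sparse_rels_def by fastforce
  then have "card (sparse_rels A B D) \<le> card (\<Union>p\<in>?S'. ?F p)"
    using finS' fin by (intro card_mono) auto
  also have "\<dots> \<le> (\<Sum>p\<in>?S'. card (?F p))"
    using finS' by (rule card_UN_le)
  finally have "card (sparse_rels A B D) * 2 ^ card B \<le> (\<Sum>p\<in>?S'. card (?F p)) * 2 ^ card B"
    by simp
  also have "\<dots> = (\<Sum>p\<in>?S'. card (?F p) * 2 ^ card B)"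
    by (rule sum_distrib_right)
  also have "\<dots> \<le> (\<Sum>p\<in>?S'. 2 ^ (card A * card B))"
    using card_odd_image_eq[OF fin] by (intro sum_mono) auto
  also have "\<dots> = card ?S' * 2 ^ (card A * card B)" by simp
  \<comment> \<open>The fibre bound needs \<open>x\<close> nonempty; the pairs with \<open>x\<close>
    empty are readmitted only now, since the weight bound counts them too.\<close>
  also have "\<dots> \<le> card ?S * 2 ^ (card A * card B)"
    using finS by (intro mult_right_mono card_mono) auto
  finally have "real (card (sparse_rels A B D) * 2 ^ card B) \<le> real (card ?S * 2 ^ (card A * card B))"
    by (simp only: of_nat_le_iff)
  then have "real (card (sparse_rels A B D)) * 2 ^ card B \<le> real (card ?S) * 2 ^ (card A * card B)"
    by simp
  then have "real (card (sparse_rels A B D)) * 2 ^ card B * t ^ D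
      \<le> real (card ?S) * 2 ^ (card A * card B) * t ^ D"
    using t by (intro mult_right_mono) auto
  also have "\<dots> = 2 ^ (card A * card B) * (real (card ?S) * t ^ D)" by simp
  also have "\<dots> \<le> 2 ^ (card A * card B) * (1 + t) ^ (card A + card B)"
    using card_sparse_pairs[OF fin t] by (intro mult_left_mono) auto
  finally show ?thesis .
qed

text \<open>The codes of \<open>E\<close> and of its transpose must both be good; the leading 2 in
  the hypothesis pays for excluding two bad families.\<close>

lemma ex_rel_not_sparse:
  fixes t :: real
  assumes fin: "finite A" "finite B" and card: "card A = n" "card B = n"
    and t: "0 < t" "t \<le> 1" and less: "2 * (1 + t) ^ (2 * n) < 2 ^ n * t ^ D"
  obtains E where "E \<subseteq> A \<times> B" "E \<notin> sparse_rels A B D" "E\<inverse> \<notin> sparse_rels B A D"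
proof -
  let ?X = "sparse_rels A B D" and ?Y = "converse ` sparse_rels B A D"
  have "card ?Y = card (sparse_rels B A D)"
    by (intro card_image inj_onI) simp
  then have "(real (card ?X) * 2 ^ n * t ^ D) + (real (card ?Y) * 2 ^ n * t ^ D)
      \<le> 2 ^ (n * n) * (1 + t) ^ (n + n) + 2 ^ (n * n) * (1 + t) ^ (n + n)"
    using card_sparse_rels[OF fin t, of D] card_sparse_rels[OF fin(2,1) t, of D]
    unfolding card by (intro add_mono) simp_all
  then have "real (card ?X + card ?Y) * (2 ^ n * t ^ D) \<le> 2 ^ (n * n) * (2 * (1 + t) ^ (2 * n))"
    by (simp only: of_nat_add distrib_left distrib_right mult.assoc mult.left_commute [of _ 2] mult_2)
  also have "\<dots> < 2 ^ (n * n) * (2 ^ n * t ^ D)"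
    using less by simp
  finally have "real (card ?X + card ?Y) < 2 ^ (n * n)"
    using t by (simp add: mult_less_cancel_right)
  then have "card ?X + card ?Y < card (Pow (A \<times> B))"
    using fin card by (simp add: card_Pow card_cartesian_product flip: of_nat_less_iff[where 'a = real])
  then have "card (?X \<union> ?Y) < card (Pow (A \<times> B))"
    using card_Un_le[of ?X ?Y] by linarith
  then have "\<not> Pow (A \<times> B) \<subseteq> ?X \<union> ?Y"
    using fin finite_sparse_rels by (metis card_mono finite_UnI finite_imageI not_le)
  then obtain E where "E \<subseteq> A \<times> B" "E \<notin> ?X" "E \<notin> ?Y" by blast
  then show ?thesis using that by (metis converse_converse image_eqI)
qed

section \<open>The bipartite graph\<close>

text \<open>
  Here \<open>t / (1 + t) = 0.11\<close>, and the inequality \<open>(1 + t) ^ 100 < 2 ^ 50 * t ^ 11\<close> says that the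
  binary entropy of \<open>0.11\<close> is less than \<open>1/2\<close>.
\<close>

lemma eventually_entropy_bound:
  fixes t :: real
  defines "t \<equiv> 11 / 89"
  shows "\<exists>n0. \<forall>n>n0. 2 * (1 + t) ^ (2 * n) < 2 ^ n * t ^ (11 * n div 50 + 1)"
proof -
  define r where "r = 2 ^ 50 * t ^ 11 / (1 + t) ^ 100"
  have t: "0 < t" "t < 1" unfolding t_def by simp_all
  have r: "1 < r" unfolding r_def t_def by (simp add: power_divide)
  \<comment> \<open>After taking 50th powers, \<open>2 ^ 50\<close> comes from the leading factor 2,
    and \<open>t ^ 50\<close> absorbs the rounding:
    \<open>50 * (11 * n div 50 + 1) \<le> 11 * n + 50\<close>.\<close>
  obtain n0 where n0: "2 ^ 50 / t ^ 50 < r ^ n0"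
    using real_arch_pow[OF r] by blast
  show ?thesis
  proof (intro exI allI impI)
    fix n assume "n > n0"
    let ?D = "11 * n div 50 + 1"
    have "2 ^ 50 / t ^ 50 < r ^ n"
      using power_increasing[of n0 n r] r \<open>n > n0\<close> by (intro less_le_trans[OF n0]) auto
    also have "r ^ n = 2 ^ (50 * n) * t ^ (11 * n) / (1 + t) ^ (100 * n)"
      unfolding r_def by (simp only: power_mult power_mult_distrib power_divide)
    finally have "2 ^ 50 * (1 + t) ^ (100 * n) < 2 ^ (50 * n) * (t ^ (11 * n) * t ^ 50)"
      using t by (simp add: field_simps)
    also have "t ^ (11 * n) * t ^ 50 \<le> t ^ (50 * ?D)"
      using t by (subst power_add[symmetric], intro power_decreasing) auto
    finally have "(2 * (1 + t) ^ (2 * n)) ^ 50 < (2 ^ n * t ^ ?D) ^ 50"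
      by (simp only: power_mult_distrib power_mult [symmetric] mult.commute [of _ 50]
        mult.assoc [symmetric]) simp
    then show "2 * (1 + t) ^ (2 * n) < 2 ^ n * t ^ ?D"
      by (rule power_less_imp_less_base) (use t in simp)
  qed
qed

definition bipartite_graph :: "'a set \<Rightarrow> 'a set \<Rightarrow> 'a rel \<Rightarrow> 'a pair_pre_digraph" where
  "bipartite_graph A B E = \<lparr>pverts = A \<union> B, parcs = E \<union> E\<inverse>\<rparr>"

text \<open>Reduces sets meeting \<open>B\<close> to sets meeting \<open>A\<close>, with
  \<open>E\<close> replaced by its converse.\<close>

lemma bipartite_graph_swap: "bipartite_graph B A (E\<inverse>) = bipartite_graph A B E"
  unfolding bipartite_graph_def by auto

lemma pair_graph_bipartite_graph:
  assumes "finite A" "finite B" "A \<inter> B = {}" "E \<subseteq> A \<times> B"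
  shows "pair_graph (bipartite_graph A B E)"
  using assms unfolding pair_graph_iff bipartite_graph_def by (auto simp: sym_def)

text \<open>Parities at vertices of \<open>B\<close> depend only on \<open>L \<inter> A\<close>.
  This part and its odd image lie on opposite sides, so their sizes add up; the rest of
  \<open>L\<close> can only enlarge the union.\<close>

lemma card_bipartite_graph_odd_image:
  assumes fin: "finite A" "finite B" and AB: "A \<inter> B = {}" "E \<subseteq> A \<times> B"
    and E: "E \<notin> sparse_rels A B D" and L: "L \<inter> A \<noteq> {}" "L \<subseteq> A \<union> B"
  shows "D < card (L \<union> odd_image (parcs (bipartite_graph A B E)) L)" (is "_ < card (L \<union> ?O)")
proof -
  let ?x = "L \<inter> A"
  have ne: "{a \<in> M. (a, v) \<in> F} \<noteq> {}" if "v \<in> odd_image F M" for v :: 'a and F M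
    using that unfolding odd_image_def by (auto simp del: Collect_empty_eq)
  have B: "odd_image E ?x \<subseteq> B" using ne AB(2) by fastforce
  have "odd_image E ?x \<subseteq> ?O"
  proof
    fix b assume b: "b \<in> odd_image E ?x"
    then have "{a \<in> L. (a, b) \<in> E \<union> E\<inverse>} = {a \<in> ?x. (a, b) \<in> E}"
      using AB B by auto
    then show "b \<in> ?O" using b unfolding odd_image_def bipartite_graph_def by simp
  qed
  moreover have "finite ?O"
  proof (rule finite_subset[of _ "A \<union> B"])
    show "?O \<subseteq> A \<union> B" using ne[of _ "E \<union> E\<inverse>"] AB(2) unfolding bipartite_graph_def by fastforce
  qed (use fin in simp)
  moreover have "finite L" using L(2) fin finite_subset by blast
  ultimately have "card (?x \<union> odd_image E ?x) \<le> card (L \<union> ?O)"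
    by (intro card_mono) auto
  moreover have "card (?x \<union> odd_image E ?x) = card ?x + card (odd_image E ?x)"
    using fin B AB(1) by (intro card_Un_disjoint) (auto intro: finite_subset)
  moreover have "D < card ?x + card (odd_image E ?x)"
    using E AB(2) L(1) unfolding sparse_rels_def by auto
  ultimately show ?thesis by linarith
qed

theorem theorem2:
  shows "\<exists>\<nu>\<^sub>0::nat. \<forall>\<nu>::nat. \<nu> > \<nu>\<^sub>0 \<longrightarrow>
    (\<exists>G :: nat pair_pre_digraph. pair_graph G \<and> bipartite G \<and> card (pverts G) = 2 * \<nu> \<and>
       real (local_min_degree G) > 0.110 * real (card (pverts G)))"
proof -
  obtain n0 where n0: "\<And>n. n > n0 \<Longrightarrow>
      2 * (1 + 11 / 89) ^ (2 * n) < 2 ^ n * (11 / 89 :: real) ^ (11 * n div 50 + 1)"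
    using eventually_entropy_bound by blast
  show ?thesis
  proof (intro exI[of _ n0] allI impI)
    fix \<nu> assume \<nu>: "\<nu> > n0"
    \<comment> \<open>The target \<open>0.11 * (2 * \<nu>)\<close> equals
      \<open>11 * \<nu> / 50\<close>; the extra 1 matches the \<open>Suc\<close> in
      \<open>less_local_min_degreeI\<close>.\<close>
    define D where "D = 11 * \<nu> div 50 + 1"
    define A B where "A = {..<\<nu>}" and "B = {\<nu>..<2 * \<nu>}"
    have AB: "finite A" "finite B" "card A = \<nu>" "card B = \<nu>" "A \<inter> B = {}"
      unfolding A_def B_def by auto
    obtain E where E: "E \<subseteq> A \<times> B" "E \<notin> sparse_rels A B D" "E\<inverse> \<notin> sparse_rels B A D"
      using ex_rel_not_sparse[OF AB(1-4), of "11 / 89" D] n0[OF \<nu>] unfolding D_def by auto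
    define G where "G = bipartite_graph A B E"
    have verts: "pverts G = A \<union> B" and arcs: "parcs G = E \<union> E\<inverse>"
      unfolding G_def bipartite_graph_def by simp_all
    have G: "pair_graph G"
      unfolding G_def using AB E(1) by (intro pair_graph_bipartite_graph)
    have bip: "bipartite G"
      unfolding bipartite_def verts arcs using AB E(1) by (intro exI[of _ A] exI[of _ B]) auto
    have card: "card (pverts G) = 2 * \<nu>"
      unfolding verts using AB by (simp add: card_Un_disjoint)
    have "Suc (11 * \<nu> div 50) < card (L \<union> odd_image (parcs G) L)"
      if L: "L \<subseteq> pverts G" "L \<noteq> {}" for L
    proof -
      have "D < card (L \<union> odd_image (parcs G) L)"
      proof (cases "L \<inter> A = {}")
        case False
        then show ?thesis
          unfolding G_def using AB E L verts by (intro card_bipartite_graph_odd_image) auto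
      next
        case True
        then have "L \<inter> B \<noteq> {}" using L verts by auto
        then show ?thesis
          unfolding G_def bipartite_graph_swap[of B A E, symmetric]
          using AB E L verts by (intro card_bipartite_graph_odd_image) auto
      qed
      then show ?thesis unfolding D_def by simp
    qed
    moreover have "pverts G \<noteq> {}" using card \<nu> by auto
    ultimately have "11 * \<nu> div 50 < local_min_degree G"
      by (intro less_local_min_degreeI[OF G])
    \<comment> \<open>An integer above the floor of \<open>11 * \<nu> / 50\<close> exceeds the
      fraction itself, so rounding loses nothing.\<close>
    then have "11 * \<nu> < 50 * local_min_degree G" by linarith
    then have "real (local_min_degree G) > 0.110 * real (card (pverts G))"
      unfolding card by simp
    then show "\<exists>G :: nat pair_pre_digraph. pair_graph G \<and> bipartite G \<and> card (pverts G) = 2 * \<nu> \<and>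
        real (local_min_degree G) > 0.110 * real (card (pverts G))"
      using G bip card by blast
  qed
qed

end
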